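(* Let $\delta\geq 2$ be an integer and let $G$ be a connected graph of even order $n\geq\max\{5\delta-3,\frac{1}{3}\delta^{2}+\delta\}$ with minimum degree $\delta(G)=\delta$. If $$\rho(G)\geq\rho\big(K_{\delta}\vee(K_{n-2\delta+1}\cup(\delta-1)K_1)\big),$$ then $G$ contains an even factor, unless $G=K_{\delta}\vee(K_{n-2\delta+1}\cup(\delta-1)K_1)$.
   Context: All graphs are finite, undirected, without loops or multiple edges. $\rho(G)$ denotes the spectral radius of $G$, i.e. the largest eigenvalue of its adjacency matrix. $K_m$ is the complete graph on $m$ vertices; $(\delta-1)K_1$ is the graph consisting of $\delta-1$ isolated vertices. $G_1\cup G_2$ is the disjoint union of vertex-disjoint graphs, and the join $G_1\vee G_2$ is obtained from $G_1\cup G_2$ by adding all edges between $V(G_1)$ and $V(G_2)$. An even factor of $G$ is a spanning subgraph $F$ of $G$ such that $d_F(v)\in\{2,4,6,\ldots\}$ for every vertex $v\in V(G)$. *)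

theory Defs
  imports
    "Graph_Theory.Digraph_Component"
    "Graph_Theory.Digraph_Isomorphism"
    "Jordan_Normal_Form.Spectral_Radius"
begin

text \<open>
  A finite simple undirected graph is a \<^locale>\<open>pair_graph\<close>: finite, loop-free, with a symmetric arc
  set, each undirected edge \<open>uv\<close> being the two arcs \<open>(u, v)\<close> and \<open>(v, u)\<close>.  Hence the degree of a
  vertex is its out-degree.
\<close>

type_synonym 'a ugraph = "'a pair_pre_digraph"

abbreviation vertex_degree :: "'a ugraph \<Rightarrow> 'a \<Rightarrow> nat" where
  "vertex_degree G v \<equiv> out_degree (with_proj G) v"

definition min_degree :: "'a ugraph \<Rightarrow> nat" where
  "min_degree G = Min (vertex_degree G ` pverts G)"

text \<open>
  Forming a matrix needs an enumeration \<open>xs\<close> of the vertices; by the lemma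
  \<open>spectrum_adjacency_mat_enum\<close> below, the spectrum does not depend on it.
\<close>

definition adjacency_mat :: "'a ugraph \<Rightarrow> 'a list \<Rightarrow> real mat" where
  "adjacency_mat G xs =
     mat (length xs) (length xs) (\<lambda>(i, j). if (xs ! i, xs ! j) \<in> parcs G then 1 else 0)"

definition graph_rho :: "'a ugraph \<Rightarrow> real" where
  "graph_rho G =
     Max (spectrum (adjacency_mat G (SOME xs. distinct xs \<and> set xs = pverts G)))"

definition complete_ugraph :: "nat \<Rightarrow> nat ugraph" where
  "complete_ugraph m =
     \<lparr>pverts = {..<m}, parcs = {(u, v). u \<in> {..<m} \<and> v \<in> {..<m} \<and> u \<noteq> v}\<rparr>"

definition isolated_ugraph :: "nat \<Rightarrow> nat ugraph" where
  "isolated_ugraph m = \<lparr>pverts = {..<m}, parcs = {}\<rparr>"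

definition graph_disjoint_union :: "'a ugraph \<Rightarrow> 'b ugraph \<Rightarrow> ('a + 'b) ugraph" where
  "graph_disjoint_union G H =
     \<lparr>pverts = pverts G <+> pverts H,
      parcs = map_prod Inl Inl ` parcs G \<union> map_prod Inr Inr ` parcs H\<rparr>"

definition graph_join :: "'a ugraph \<Rightarrow> 'b ugraph \<Rightarrow> ('a + 'b) ugraph" where
  "graph_join G H =
     (let U = graph_disjoint_union G H in
      \<lparr>pverts = pverts U,
       parcs = parcs U \<union> (Inl ` pverts G) \<times> (Inr ` pverts H) \<union> (Inr ` pverts H) \<times> (Inl ` pverts G)\<rparr>)"

definition extremal_graph :: "nat \<Rightarrow> nat \<Rightarrow> (nat + nat + nat) ugraph" where
  "extremal_graph n \<delta> =
     graph_join (complete_ugraph \<delta>)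
       (graph_disjoint_union (complete_ugraph (n - 2 * \<delta> + 1)) (isolated_ugraph (\<delta> - 1)))"

definition even_factor :: "'a ugraph \<Rightarrow> 'a ugraph \<Rightarrow> bool" where
  "even_factor F G \<longleftrightarrow>
     pair_graph F \<and> spanning (with_proj F) (with_proj G) \<and>
     (\<forall>v \<in> pverts G. even (vertex_degree F v) \<and> vertex_degree F v \<ge> 2)"

lemma pair_graphI:
  assumes "finite (pverts G)" "\<And>u v. (u, v) \<in> parcs G \<Longrightarrow> u \<in> pverts G \<and> v \<in> pverts G \<and> u \<noteq> v"
    "\<And>u v. (u, v) \<in> parcs G \<Longrightarrow> (v, u) \<in> parcs G"
  shows "pair_graph G"
proof -
  have "parcs G \<subseteq> pverts G \<times> pverts G" using assms(2) by auto
  then have "finite (parcs G)" using assms(1) by (meson finite_SigmaI finite_subset)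
  then show ?thesis
    using assms by unfold_locales (force simp: symmetric_def intro: symI)+
qed

lemma pair_graphD:
  assumes "pair_graph G"
  shows "finite (pverts G)" "\<And>u v. (u, v) \<in> parcs G \<Longrightarrow> u \<in> pverts G \<and> v \<in> pverts G \<and> u \<noteq> v"
    "\<And>u v. (u, v) \<in> parcs G \<Longrightarrow> (v, u) \<in> parcs G"
proof -
  interpret pair_graph G by fact
  show "finite (pverts G)" by (rule pair_finite_verts)
  show "u \<in> pverts G \<and> v \<in> pverts G \<and> u \<noteq> v" if "(u, v) \<in> parcs G" for u v
    using that pair_no_loops wellformed' by fastforce
  show "(v, u) \<in> parcs G" if "(u, v) \<in> parcs G" for u v
    using that pair_sym_arcs by (auto simp: symmetric_def dest: symD)
qed

lemma pair_graph_complete_ugraph: "pair_graph (complete_ugraph m)"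
  by (rule pair_graphI) (auto simp: complete_ugraph_def)

lemma pair_graph_isolated_ugraph: "pair_graph (isolated_ugraph m)"
  by (rule pair_graphI) (auto simp: isolated_ugraph_def)

lemma pair_graph_disjoint_union:
  assumes "pair_graph G" "pair_graph H"
  shows "pair_graph (graph_disjoint_union G H)"
  using pair_graphD[OF assms(1)] pair_graphD[OF assms(2)]
  by (intro pair_graphI) (auto simp: graph_disjoint_union_def, blast+)

lemma pair_graph_join:
  assumes "pair_graph G" "pair_graph H"
  shows "pair_graph (graph_join G H)"
  using pair_graphD[OF assms(1)] pair_graphD[OF assms(2)]
  by (intro pair_graphI) (auto simp: graph_disjoint_union_def graph_join_def, blast+)

lemma pair_graph_extremal_graph: "pair_graph (extremal_graph n \<delta>)"
  unfolding extremal_graph_def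
  by (intro pair_graph_join pair_graph_disjoint_union pair_graph_complete_ugraph
      pair_graph_isolated_ugraph)

lemma card_extremal_graph:
  assumes "\<delta> \<ge> 1" "n \<ge> 2 * \<delta>"
  shows "card (pverts (extremal_graph n \<delta>)) = n"
  using assms
  by (simp add: extremal_graph_def graph_join_def graph_disjoint_union_def complete_ugraph_def
      isolated_ugraph_def card_Plus)

lemma eigenvalue_adjacency_mat_iff:
  assumes "distinct xs" "set xs = pverts G"
  shows "eigenvalue (adjacency_mat G xs) k \<longleftrightarrow>
    (\<exists>f. (\<exists>v\<in>pverts G. f v \<noteq> 0) \<and>
      (\<forall>v\<in>pverts G. (\<Sum>u\<in>pverts G. (if (v, u) \<in> parcs G then 1 else 0) * f u) = k * f v))"
    (is "?L \<longleftrightarrow> ?R")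
proof -
  let ?n = "length xs"
  let ?a = "\<lambda>v u. if (v, u) \<in> parcs G then 1 else (0::real)"
  have bij: "bij_betw ((!) xs) {0..<?n} (pverts G)"
    using bij_betw_nth[OF assms(1), of "{0..<?n}"] assms(2) by (simp add: atLeast0LessThan)
  have sum: "(\<Sum>u\<in>pverts G. g u) = (\<Sum>j\<in>{0..<?n}. g (xs ! j))" for g :: "'a \<Rightarrow> real"
    using sum.reindex_bij_betw[OF bij, of g] by simp
  have ball: "(\<forall>v\<in>pverts G. P v) \<longleftrightarrow> (\<forall>i<?n. P (xs ! i))" for P
    using assms(2) by (metis all_set_conv_all_nth)
  have nz: "w \<noteq> 0\<^sub>v ?n \<longleftrightarrow> (\<exists>i<?n. w $ i \<noteq> 0)" if "w \<in> carrier_vec ?n" for w :: "real vec"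
    using that by (auto simp: vec_eq_iff)
  have mv: "adjacency_mat G xs *\<^sub>v w = k \<cdot>\<^sub>v w \<longleftrightarrow>
      (\<forall>i<?n. (\<Sum>j\<in>{0..<?n}. ?a (xs ! i) (xs ! j) * w $ j) = k * w $ i)"
    if "w \<in> carrier_vec ?n" for w
    using that
    by (auto simp: vec_eq_iff adjacency_mat_def scalar_prod_def intro!: sum.cong)
  have dim: "dim_row (adjacency_mat G xs) = ?n" by (simp add: adjacency_mat_def)
  show ?thesis
  proof
    assume ?L
    then obtain w where w: "w \<in> carrier_vec ?n" "w \<noteq> 0\<^sub>v ?n"
      "adjacency_mat G xs *\<^sub>v w = k \<cdot>\<^sub>v w"
      by (auto simp: eigenvalue_def eigenvector_def dim)
    define f where "f = (\<lambda>v. w $ (inv_into {0..<?n} ((!) xs) v))"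
    have f: "f (xs ! i) = w $ i" if "i < ?n" for i
      using bij that by (simp add: f_def bij_betw_inv_into_left)
    have "\<exists>v\<in>pverts G. f v \<noteq> 0"
      using w(2) nz[OF w(1)] f assms(2) by (metis nth_mem)
    moreover have "\<forall>v\<in>pverts G. (\<Sum>u\<in>pverts G. ?a v u * f u) = k * f v"
      using w(3) unfolding mv[OF w(1)] ball sum by (simp add: f)
    ultimately show ?R by blast
  next
    assume ?R
    then obtain f where f: "\<exists>v\<in>pverts G. f v \<noteq> 0"
      "\<forall>v\<in>pverts G. (\<Sum>u\<in>pverts G. ?a v u * f u) = k * f v" by blast
    define w where "w = vec ?n (\<lambda>i. f (xs ! i))"
    have w: "w \<in> carrier_vec ?n" by (simp add: w_def)
    have "w \<noteq> 0\<^sub>v ?n"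
      unfolding nz[OF w] using f(1) ball[of "\<lambda>v. f v = 0"] by (auto simp: w_def)
    moreover have "adjacency_mat G xs *\<^sub>v w = k \<cdot>\<^sub>v w"
      using f(2) unfolding mv[OF w] ball sum by (simp add: w_def)
    ultimately show ?L
      using w by (auto simp: eigenvalue_def eigenvector_def dim)
  qed
qed

lemma spectrum_adjacency_mat_enum:
  assumes "distinct xs" "set xs = pverts G" "distinct ys" "set ys = pverts G"
  shows "spectrum (adjacency_mat G xs) = spectrum (adjacency_mat G ys)"
  using assms by (auto simp: spectrum_def eigenvalue_adjacency_mat_iff)

end

theory Submission
  imports Defs
begin

text \<open>
  Choose an even subgraph with the most edges and, subject to that, the most vertices of positive
  degree.  If it misses a vertex \<open>v\<close>, then exchanging along triangles and 4-cycles through \<open>v\<close> shows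
  that the neighbours of \<open>v\<close> are independent and that no other vertex has more than two of them as
  neighbours.  So \<open>G\<close> has few edges.  On the other hand, every eigenvalue
  \<open>k \<ge> max 0 (\<delta> - 1)\<close> satisfies \<open>k * (k - \<delta> + 1) \<le> 2 * m - (n - 1) * \<delta>\<close> where \<open>m\<close> is the number of
  edges, and the extremal graph, which properly contains \<open>K\<^bsub>n - \<delta> + 1\<^esub>\<close>, has an eigenvalue above
  \<open>n - \<delta>\<close>.  So \<open>G\<close> has many edges, a contradiction.
\<close>

section \<open>Exchange in even subgraphs\<close>

lemma even_card_sym_diff:
  assumes "finite A" "finite B" "even (card A)" "even (card B)"
  shows "even (card ((A - B) \<union> (B - A)))"
proof -
  have "card A = card (A - B) + card (A \<inter> B)"
    by (metis assms(1) card_Diff_subset_Int card_mono finite_Int inf_le1 le_add_diff_inverse2)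
  moreover have "card B = card (B - A) + card (A \<inter> B)"
    by (metis assms(2) card_Diff_subset_Int card_mono finite_Int inf_commute inf_le1
        le_add_diff_inverse2)
  moreover have "card ((A - B) \<union> (B - A)) = card (A - B) + card (B - A)"
    using assms by (intro card_Un_disjoint) auto
  ultimately show ?thesis
    using assms(3,4) by presburger
qed

text \<open>Exchanging \<open>A\<close> along \<open>B\<close> gains \<open>B - A\<close> and loses
  \<open>A \<inter> B\<close>; the additive form lets gains and losses be compared without
  subtraction on naturals.\<close>

lemma card_sym_diff_add:
  assumes "finite A" "finite B"
  shows "card ((A - B) \<union> (B - A)) + card (A \<inter> B) = card A + card (B - A)"
proof -
  have "card ((A - B) \<union> (B - A)) = card (A - B) + card (B - A)"
    using assms by (intro card_Un_disjoint) auto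
  moreover have "card A = card (A - B) + card (A \<inter> B)"
    by (metis assms(1) card_Diff_subset_Int card_mono finite_Int inf_le1 le_add_diff_inverse2)
  ultimately show ?thesis by simp
qed

text \<open>Encodes the edge set of an even subgraph, each edge as two pairs. Degree 0 is allowed,
  unlike in an even factor, so that within a finite graph these sets are closed under symmetric
  difference. The vertices of positive degree are \<open>Domain P\<close>.\<close>

definition even_rel :: "'a rel \<Rightarrow> bool" where
  "even_rel P \<longleftrightarrow> sym P \<and> (\<forall>v. even (card (P `` {v})))"

lemma even_rel_sym_diff:
  assumes "finite P" "finite C" "even_rel P" "even_rel C"
  shows "even_rel ((P - C) \<union> (C - P))"
proof -
  have "((P - C) \<union> (C - P)) `` {v} = (P `` {v} - C `` {v}) \<union> (C `` {v} - P `` {v})" for v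
    by auto
  moreover have "finite (P `` {v})" "finite (C `` {v})" for v
    using assms(1,2) by (auto intro: finite_Image)
  moreover have "sym ((P - C) \<union> (C - P))"
    using assms(3,4) unfolding even_rel_def sym_def by blast
  ultimately show ?thesis
    using assms(3,4) by (simp add: even_rel_def even_card_sym_diff)
qed

text \<open>There are finitely many candidates and the empty relation is one of them, so both
  successive maxima are attained.\<close>

lemma exists_even_rel_lex_max:
  assumes "finite (E :: 'a rel)"
  obtains P where "P \<subseteq> E" "even_rel P"
    "\<And>Q. Q \<subseteq> E \<Longrightarrow> even_rel Q \<Longrightarrow> card Q \<le> card P"
    "\<And>Q. Q \<subseteq> E \<Longrightarrow> even_rel Q \<Longrightarrow> card Q = card P \<Longrightarrow> card (Domain Q) \<le> card (Domain P)"
proof -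
  define S where "S = {P. P \<subseteq> E \<and> even_rel P}"
  have S: "finite S" "{} \<in> S"
    using assms by (auto simp: S_def even_rel_def sym_def)
  define M where "M = Max (card ` S)"
  define T where "T = {P \<in> S. card P = M}"
  have "M \<in> card ` S"
    using S by (auto simp: M_def intro!: Max_in)
  then have T: "finite T" "T \<noteq> {}"
    using S by (auto simp: T_def)
  have "Max ((\<lambda>P. card (Domain P)) ` T) \<in> (\<lambda>P. card (Domain P)) ` T"
    using T by (intro Max_in) auto
  then obtain P where P: "P \<in> T" "card (Domain P) = Max ((\<lambda>P. card (Domain P)) ` T)"
    by auto
  show thesis
  proof (rule that)
    show "P \<subseteq> E" "even_rel P"
      using P(1) by (auto simp: T_def S_def)
    show "card Q \<le> card P" if "Q \<subseteq> E" "even_rel Q" for Q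
      using P(1) S(1) that by (auto simp: T_def M_def S_def intro!: Max_ge)
    show "card (Domain Q) \<le> card (Domain P)" if "Q \<subseteq> E" "even_rel Q" "card Q = card P" for Q
      using P T(1) that by (auto simp: T_def S_def intro!: Max_ge)
  qed
qed

lemma even_rel_triangle:
  assumes "v \<noteq> a" "v \<noteq> b" "a \<noteq> b"
  shows "even_rel {(v, a), (a, v), (v, b), (b, v), (a, b), (b, a)}" (is "even_rel ?C")
proof -
  have "?C `` {u} = (if u = v then {a, b} else if u = a then {v, b} else
      if u = b then {v, a} else {})" for u
    using assms by auto
  then show ?thesis
    using assms by (simp add: even_rel_def sym_def)
qed

lemma even_rel_square:
  assumes "v \<noteq> a" "v \<noteq> b" "a \<noteq> b" "w \<noteq> v" "w \<noteq> a" "w \<noteq> b"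
  shows "even_rel {(v, a), (a, v), (v, b), (b, v), (a, w), (w, a), (b, w), (w, b)}"
    (is "even_rel ?C")
proof -
  have "?C `` {u} = (if u = v then {a, b} else if u = a then {v, w} else
      if u = b then {v, w} else if u = w then {a, b} else {})" for u
    using assms by auto
  then show ?thesis
    using assms by (simp add: even_rel_def sym_def)
qed

text \<open>Let \<open>P\<close> be lexicographically maximal and miss \<open>v\<close>. Adding
  modulo 2 a cycle through \<open>v\<close> gains both cycle edges at \<open>v\<close>. A triangle
  loses at most one edge, so none exists. A 4-cycle \<open>v, a, w, b\<close> must lose both edges
  at \<open>w\<close>, and maximality of \<open>Domain P\<close> then makes \<open>a\<close> and
  \<open>b\<close> the only \<open>P\<close>-neighbours of \<open>w\<close>.\<close>

lemma sparse_neighbourhood_of_uncovered_vertex: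
  assumes "finite (E :: 'a rel)" "sym E" "irrefl E"
    and uncovered: "\<And>P. P \<subseteq> E \<Longrightarrow> even_rel P \<Longrightarrow> \<not> V \<subseteq> Domain P"
  obtains v where "v \<in> V" "\<And>a b. (v, a) \<in> E \<Longrightarrow> (v, b) \<in> E \<Longrightarrow> (a, b) \<notin> E"
    "\<And>w. w \<noteq> v \<Longrightarrow> card (E `` {w} \<inter> E `` {v}) \<le> 2"
proof -
  obtain P where P: "P \<subseteq> E" "even_rel P"
    and max1: "\<And>Q. Q \<subseteq> E \<Longrightarrow> even_rel Q \<Longrightarrow> card Q \<le> card P"
    and max2: "\<And>Q. Q \<subseteq> E \<Longrightarrow> even_rel Q \<Longrightarrow> card Q = card P \<Longrightarrow> card (Domain Q) \<le> card (Domain P)"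
    using exists_even_rel_lex_max[OF assms(1)] by blast
  have finP: "finite P" using P(1) assms(1) finite_subset by blast
  have symE: "(b, a) \<in> E" if "(a, b) \<in> E" for a b using that assms(2) by (auto dest: symD)
  have symP: "(a, b) \<in> P \<longleftrightarrow> (b, a) \<in> P" for a b using P(2) by (auto simp: even_rel_def dest: symD)
  have neqE: "a \<noteq> b" if "(a, b) \<in> E" for a b using that assms(3) by (auto simp: irrefl_def)
  obtain v where v: "v \<in> V" "v \<notin> Domain P"
    using uncovered[OF P] by blast
  \<comment> \<open>The symmetric difference of \<open>P\<close> and \<open>C\<close> competes with
    \<open>P\<close>, so it cannot gain more pairs than it loses.\<close>
  have no_gain: "card (C - P) \<le> card (P \<inter> C)" if "C \<subseteq> E" "even_rel C" for C
  proof -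
    have finC: "finite C" using that(1) assms(1) finite_subset by blast
    have "card ((P - C) \<union> (C - P)) \<le> card P"
      using that P by (intro max1 even_rel_sym_diff finP finC) auto
    then show ?thesis
      using card_sym_diff_add[OF finP finC] by linarith
  qed
  have vP: "(v, a) \<notin> P" "(a, v) \<notin> P" for a
    using v(2) symP[of v a] by auto
  have indep: "(a, b) \<notin> E" if ab: "(v, a) \<in> E" "(v, b) \<in> E" for a b
  proof
    assume e: "(a, b) \<in> E"
    let ?C = "{(v, a), (a, v), (v, b), (b, v), (a, b), (b, a)}"
    have ne: "v \<noteq> a" "v \<noteq> b" "a \<noteq> b" using ab e neqE by auto
    have "card {(v, a), (a, v), (v, b), (b, v)} \<le> card (?C - P)"
      using vP by (intro card_mono) auto
    moreover have "card (P \<inter> ?C) \<le> card {(a, b), (b, a)}"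
      using vP by (intro card_mono) auto
    moreover have "card (?C - P) \<le> card (P \<inter> ?C)"
      using ab e symE ne by (intro no_gain even_rel_triangle) auto
    ultimately show False
      using ne by simp
  qed
  have PW: "P `` {w} = {a, b}"
    if ab: "(v, a) \<in> E" "(v, b) \<in> E" "a \<noteq> b" and w: "w \<noteq> v" "(w, a) \<in> E" "(w, b) \<in> E" for a b w
  proof (rule ccontr)
    assume neg: "P `` {w} \<noteq> {a, b}"
    let ?C = "{(v, a), (a, v), (v, b), (b, v), (a, w), (w, a), (b, w), (w, b)}"
    have ne: "v \<noteq> a" "v \<noteq> b" "w \<noteq> a" "w \<noteq> b" using ab w neqE by auto
    have C: "?C \<subseteq> E" "even_rel ?C"
      using ab w symE ne by (auto intro!: even_rel_square)
    have ng: "card (?C - P) \<le> card (P \<inter> ?C)" by (rule no_gain[OF C])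
    \<comment> \<open>If the edge between \<open>c\<close> and \<open>w\<close> were outside
      \<open>P\<close>, the exchange would gain at least six pairs and lose at most two.\<close>
    have inP: "(c, w) \<in> P" if c: "c = a \<and> c' = b \<or> c = b \<and> c' = a" for c c'
    proof (rule ccontr)
      assume "(c, w) \<notin> P"
      then have "card {(v, a), (a, v), (v, b), (b, v), (c, w), (w, c)} \<le> card (?C - P)"
        using vP c symP[of c w] by (intro card_mono) auto
      moreover have "card (P \<inter> ?C) \<le> card {(c', w), (w, c')}"
        using vP c symP[of c w] \<open>(c, w) \<notin> P\<close> by (intro card_mono) auto
      ultimately show False
        using ng ne ab(3) w(1) c by auto
    qed
    have inP': "(a, w) \<in> P" "(b, w) \<in> P" "(w, a) \<in> P" "(w, b) \<in> P"
      using inP symP by blast+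
    \<comment> \<open>The exchange is now balanced, four pairs against four. A further
      \<open>P\<close>-neighbour \<open>x\<close> keeps \<open>w\<close> covered when its edges to
      \<open>a\<close> and \<open>b\<close> go.\<close>
    then obtain x where x: "(w, x) \<in> P" "x \<noteq> a" "x \<noteq> b"
      using neg by blast
    define Q where "Q = (P - ?C) \<union> (?C - P)"
    have diff: "?C - P = {(v, a), (a, v), (v, b), (b, v)}"
      and int: "P \<inter> ?C = {(a, w), (w, a), (b, w), (w, b)}"
      using vP inP' ne by auto
    have "card (?C - P) = 4" "card (P \<inter> ?C) = 4"
      unfolding diff int using ne ab(3) w(1) by auto
    then have "card Q = card P"
      using card_sym_diff_add[OF finP, of ?C] unfolding Q_def by simp
    moreover have "Q \<subseteq> E"
      unfolding Q_def using P(1) C(1) by blast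
    moreover have "even_rel Q"
      unfolding Q_def using P(2) C(2) finP by (intro even_rel_sym_diff) simp_all
    ultimately have "card (Domain Q) \<le> card (Domain P)"
      by (intro max2)
    \<comment> \<open>Only the four cycle vertices change their edges: \<open>v\<close>,
      \<open>a\<close>, \<open>b\<close> are covered by new edges and \<open>w\<close> by its edge
      to \<open>x\<close>. So \<open>Q\<close> covers \<open>v\<close> in addition to all of
      \<open>Domain P\<close>.\<close>
    moreover have "insert v (Domain P) \<subseteq> Domain Q"
    proof
      fix u assume u: "u \<in> insert v (Domain P)"
      have new: "(v, a) \<in> Q" "(a, v) \<in> Q" "(b, v) \<in> Q"
        unfolding Q_def diff by simp_all
      have kept: "(u', y) \<in> Q" if "(u', y) \<in> P" "(u', y) \<notin> ?C" for u' y
        unfolding Q_def using that by (intro UnI1 DiffI)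
      consider "u \<in> {v, a, b}" | "u = w" | "u \<notin> {v, a, b, w}" by blast
      then show "u \<in> Domain Q"
      proof cases
        case 1
        then show ?thesis using new by blast
      next
        case 2
        have "(w, x) \<in> Q" using x ne w(1) by (intro kept) simp_all
        then show ?thesis using 2 by blast
      next
        case 3
        then obtain y where "(u, y) \<in> P" using u by blast
        then have "(u, y) \<in> Q" using 3 by (intro kept) simp_all
        then show ?thesis by blast
      qed
    qed
    moreover have "finite Q"
      using \<open>Q \<subseteq> E\<close> assms(1) finite_subset by blast
    ultimately have "card (insert v (Domain P)) \<le> card (Domain P)"
      by (meson card_mono finite_Domain le_trans)
    then show False
      using v(2) finP by (simp add: finite_Domain)
  qed
  have "card (E `` {w} \<inter> E `` {v}) \<le> 2" if w: "w \<noteq> v" for w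
  proof (cases "\<exists>a b. a \<in> E `` {w} \<inter> E `` {v} \<and> b \<in> E `` {w} \<inter> E `` {v} \<and> a \<noteq> b")
    case True
    then obtain a b where ab: "a \<in> E `` {w} \<inter> E `` {v}" "b \<in> E `` {w} \<inter> E `` {v}" "a \<noteq> b"
      by blast
    \<comment> \<open>Any two common neighbours already form the whole
      \<open>P\<close>-neighbourhood of \<open>w\<close>, so there is no third.\<close>
    have "c \<in> {a, b}" if c: "c \<in> E `` {w} \<inter> E `` {v}" for c
    proof (cases "c = a")
      case False
      then have "P `` {w} = {a, c}" "P `` {w} = {a, b}"
        using ab c w PW by auto
      then show ?thesis by blast
    qed simp
    then have "card (E `` {w} \<inter> E `` {v}) \<le> card {a, b}"
      by (intro card_mono) auto
    then show ?thesis using ab(3) by simp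
  next
    case False
    then show ?thesis
      by (metis One_nat_def assms(1) card_le_Suc0_iff_eq finite_Image finite_Int le_SucI
          numeral_2_eq_2)
  qed
  then show thesis
    using that v(1) indep by blast
qed

section \<open>Counting edges around a sparse neighbourhood\<close>

text \<open>\<open>card E\<close> counts ordered pairs, twice the number of edges. With
  \<open>N\<close> the neighbours of \<open>v\<close> and \<open>W\<close> the \<open>r\<close>
  remaining vertices, there are \<open>2 * card N\<close> pairs at \<open>v\<close>, none inside
  \<open>N\<close>, at most \<open>2 * r\<close> in each direction between \<open>W\<close> and
  \<open>N\<close>, and at most \<open>r * (r - 1)\<close> inside \<open>W\<close>.\<close>

lemma card_le_of_sparse_neighbourhood:
  assumes "finite V" "E \<subseteq> V \<times> V" "sym E" "irrefl E" "v \<in> V"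
    and indep: "\<And>a b. (v, a) \<in> E \<Longrightarrow> (v, b) \<in> E \<Longrightarrow> (a, b) \<notin> E"
    and few: "\<And>w. w \<noteq> v \<Longrightarrow> card (E `` {w} \<inter> E `` {v}) \<le> 2"
    and card: "card V = 1 + card (E `` {v}) + r"
  shows "card E \<le> r * r + 3 * r + 2 * card (E `` {v})"
proof -
  define N where "N = E `` {v}"
  define W where "W = V - N - {v}"
  have NV: "N \<subseteq> V" "v \<notin> N" using assms(2,4) by (auto simp: N_def irrefl_def)
  have fin: "finite N" "finite W" using NV(1) assms(1) finite_subset by (auto simp: W_def)
  have "card W = r"
    using NV assms(1,5) fin card
    by (simp add: W_def N_def[symmetric] card_Diff_subset)
  define X where "X = Sigma W (\<lambda>w. E `` {w} \<inter> N)"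
  have "card X = (\<Sum>w\<in>W. card (E `` {w} \<inter> N))"
    using fin by (simp add: X_def)
  also have "\<dots> \<le> (\<Sum>w\<in>W. 2)"
    using few by (intro sum_mono) (auto simp: W_def N_def)
  finally have X: "card X \<le> 2 * r" using \<open>card W = r\<close> by simp
  have "finite X" using fin by (simp add: X_def)
  then have XC: "card (X\<inverse>) \<le> 2 * r" "finite (X\<inverse>)" using X by simp_all
  have "card (W \<times> W - Id_on W) = r * r - r"
  proof -
    have "Id_on W = (\<lambda>w. (w, w)) ` W" by auto
    then have "card (Id_on W) = r" using \<open>card W = r\<close> by (simp add: card_image inj_on_def)
    moreover have "Id_on W \<subseteq> W \<times> W" "finite (Id_on W)" using fin by (auto simp: Id_on_def)
    ultimately show ?thesis using \<open>card W = r\<close> fin by (simp add: card_Diff_subset)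
  qed
  then have WW: "card (W \<times> W - Id_on W) + r = r * r"
    by (cases r) auto
  have "E \<subseteq> {v} \<times> N \<union> N \<times> {v} \<union> X \<union> X\<inverse> \<union> (W \<times> W - Id_on W)"
  proof (rule subrelI)
    fix a b assume e: "(a, b) \<in> E"
    then have "a \<in> V" "b \<in> V" "a \<noteq> b" "(b, a) \<in> E"
      using assms(2-4) by (auto simp: irrefl_def dest: symD)
    then show "(a, b) \<in> {v} \<times> N \<union> N \<times> {v} \<union> X \<union> X\<inverse> \<union> (W \<times> W - Id_on W)"
      using e indep[of a b] NV(2) by (auto simp: N_def W_def X_def)
  qed
  then have "card E \<le> card ({v} \<times> N \<union> N \<times> {v} \<union> X \<union> X\<inverse> \<union> (W \<times> W - Id_on W))"
    using fin \<open>finite X\<close> XC by (intro card_mono) auto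
  also have "\<dots> \<le> card ({v} \<times> N) + card (N \<times> {v}) + card X + card (X\<inverse>) + card (W \<times> W - Id_on W)"
    by (meson add_mono card_Un_le le_refl order_trans)
  also have "\<dots> \<le> card N + card N + 2 * r + 2 * r + card (W \<times> W - Id_on W)"
    using X XC(1) by (simp add: card_cartesian_product)
  finally show ?thesis using WW by (simp add: N_def)
qed

section \<open>Eigenvalues\<close>

text \<open>A complex eigenvalue exists, symmetry makes it real, and the real or the imaginary part
  of its eigenvector is a real eigenvector.\<close>

lemma symmetric_real_mat_has_eigenvalue:
  fixes A :: "real mat"
  assumes A: "A \<in> carrier_mat n n" and sym: "\<And>i j. i < n \<Longrightarrow> j < n \<Longrightarrow> A $$ (i, j) = A $$ (j, i)"
    and "n > 0"
  obtains k where "eigenvalue A k"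
proof -
  let ?B = "map_mat complex_of_real A"
  have B: "?B \<in> carrier_mat n n" using A by simp
  obtain \<mu> where "\<mu> \<in> spectrum ?B"
    using spectrum_non_empty[OF B] \<open>n > 0\<close> by auto
  then obtain w where w: "w \<in> carrier_vec n" "w \<noteq> 0\<^sub>v n" "?B *\<^sub>v w = \<mu> \<cdot>\<^sub>v w"
    using B by (auto simp: spectrum_def eigenvalue_def eigenvector_def)
  have eq: "(\<Sum>j<n. of_real (A $$ (i, j)) * w $ j) = \<mu> * w $ i" if "i < n" for i
  proof -
    have "(?B *\<^sub>v w) $ i = (\<Sum>j<n. of_real (A $$ (i, j)) * w $ j)"
      using that A w(1) by (auto simp: scalar_prod_def atLeast0LessThan intro!: sum.cong)
    then show ?thesis using w that by simp
  qed
  \<comment> \<open>\<open>s\<close> is the squared norm of \<open>w\<close> and \<open>q\<close>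
    the Hermitian form of the matrix at \<open>w\<close>. Both are fixed by conjugation, so
    \<open>q = \<mu> * s\<close> with \<open>s \<noteq> 0\<close> makes \<open>\<mu>\<close>
    real.\<close>
  define s where "s = (\<Sum>i<n. cnj (w $ i) * w $ i)"
  define q where "q = (\<Sum>i<n. \<Sum>j<n. of_real (A $$ (i, j)) * (cnj (w $ i) * w $ j))"
  have s_real: "s = of_real (\<Sum>i<n. (cmod (w $ i))\<^sup>2)"
    by (simp add: s_def complex_norm_square mult.commute del: of_real_power)
  obtain i0 where i0: "i0 < n" "w $ i0 \<noteq> 0"
    using w(1,2) by (auto simp: vec_eq_iff)
  have "(\<Sum>i<n. (cmod (w $ i))\<^sup>2) > 0"
    by (rule sum_pos2[of _ i0]) (use i0 in auto)
  then have s0: "s \<noteq> 0" "cnj s = s"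
    unfolding s_real by (simp_all only: of_real_eq_0_iff complex_cnj_complex_of_real)
  have "q = (\<Sum>i<n. cnj (w $ i) * (\<Sum>j<n. of_real (A $$ (i, j)) * w $ j))"
    by (simp add: q_def sum_distrib_left algebra_simps)
  also have "\<dots> = (\<Sum>i<n. cnj (w $ i) * (\<mu> * w $ i))"
    by (intro sum.cong refl) (simp add: eq)
  also have "\<dots> = \<mu> * s"
    by (simp add: s_def sum_distrib_left algebra_simps)
  finally have q: "q = \<mu> * s" .
  have "cnj q = (\<Sum>i<n. \<Sum>j<n. of_real (A $$ (i, j)) * (w $ i * cnj (w $ j)))"
    by (simp add: q_def)
  also have "\<dots> = (\<Sum>j<n. \<Sum>i<n. of_real (A $$ (i, j)) * (w $ i * cnj (w $ j)))"
    by (rule sum.swap)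
  also have "\<dots> = q"
    unfolding q_def by (intro sum.cong refl) (simp add: sym mult.commute)
  finally have "cnj \<mu> = \<mu>"
    using q s0 by simp
  then have mu: "\<mu> = of_real (Re \<mu>)"
    by (metis complex_cnj_cancel_iff complex_is_Real_iff Reals_cnj_iff of_real_Re)
  have eig: "eigenvalue A (Re \<mu>)" if g: "\<And>i. i < n \<Longrightarrow> (\<Sum>j<n. A $$ (i, j) * g j) = Re \<mu> * g i"
    and nz: "g i0 \<noteq> 0" for g
  proof -
    have "vec n g \<noteq> 0\<^sub>v n" using nz i0(1) by (auto simp: vec_eq_iff)
    moreover have "A *\<^sub>v vec n g = Re \<mu> \<cdot>\<^sub>v vec n g"
      using A g by (intro eq_vecI) (auto simp: scalar_prod_def atLeast0LessThan)
    ultimately show ?thesis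
      using A by (auto simp: eigenvalue_def eigenvector_def intro!: exI[of _ "vec n g"])
  qed
  have eq': "(\<Sum>j<n. of_real (A $$ (i, j)) * w $ j) = of_real (Re \<mu>) * w $ i" if "i < n" for i
    using eq[OF that] mu by metis
  have "Re (w $ i0) \<noteq> 0 \<or> Im (w $ i0) \<noteq> 0" using i0(2) by (simp add: complex_eq_iff)
  then show thesis
  proof
    assume "Re (w $ i0) \<noteq> 0"
    moreover have "(\<Sum>j<n. A $$ (i, j) * Re (w $ j)) = Re \<mu> * Re (w $ i)" if "i < n" for i
      using arg_cong[OF eq'[OF that], of Re] by simp
    ultimately show thesis using eig[of "\<lambda>i. Re (w $ i)"] that by blast
  next
    assume "Im (w $ i0) \<noteq> 0"
    moreover have "(\<Sum>j<n. A $$ (i, j) * Im (w $ j)) = Re \<mu> * Im (w $ i)" if "i < n" for i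
      using arg_cong[OF eq'[OF that], of Im] by simp
    ultimately show thesis using eig[of "\<lambda>i. Im (w $ i)"] that by blast
  qed
qed

section \<open>The spectral radius as an attained maximum\<close>

lemma ex_enumeration:
  assumes "finite V"
  shows "distinct (SOME xs. distinct xs \<and> set xs = V) \<and> set (SOME xs. distinct xs \<and> set xs = V) = V"
proof -
  obtain xs where "distinct xs \<and> set xs = V"
    using finite_distinct_list[OF assms] by blast
  then show ?thesis
    by (rule someI[of "\<lambda>xs. distinct xs \<and> set xs = V"])
qed

lemma eigenvalue_le_graph_rho:
  assumes "pair_graph G" "v \<in> pverts G" "f v \<noteq> 0"
    "\<And>v. v \<in> pverts G \<Longrightarrow> (\<Sum>u\<in>pverts G. (if (v, u) \<in> parcs G then 1 else 0) * f u) = k * f v"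
  shows "k \<le> graph_rho G"
proof -
  let ?xs = "SOME xs. distinct xs \<and> set xs = pverts G"
  have xs: "distinct ?xs" "set ?xs = pverts G"
    using ex_enumeration[OF pair_graphD(1)[OF assms(1)]] by auto
  have "adjacency_mat G ?xs \<in> carrier_mat (length ?xs) (length ?xs)"
    by (simp add: adjacency_mat_def)
  then have "finite (spectrum (adjacency_mat G ?xs))"
    by (rule card_finite_spectrum(1))
  moreover have "k \<in> spectrum (adjacency_mat G ?xs)"
    unfolding spectrum_def mem_Collect_eq eigenvalue_adjacency_mat_iff[OF xs]
    using assms(2-4) by blast
  ultimately show ?thesis
    unfolding graph_rho_def by (rule Max_ge)
qed

text \<open>Symmetry of the adjacency matrix makes its real spectrum nonempty, so the
  \<open>Max\<close> defining \<open>graph_rho\<close> is itself an eigenvalue.\<close>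

lemma graph_rho_eigenvector:
  assumes "pair_graph G" "pverts G \<noteq> {}"
  obtains f where "\<exists>v\<in>pverts G. f v \<noteq> 0"
    "\<And>v. v \<in> pverts G \<Longrightarrow>
      (\<Sum>u\<in>pverts G. (if (v, u) \<in> parcs G then 1 else 0) * f u) = graph_rho G * f v"
proof -
  let ?xs = "SOME xs. distinct xs \<and> set xs = pverts G"
  let ?A = "adjacency_mat G ?xs"
  have xs: "distinct ?xs" "set ?xs = pverts G"
    using ex_enumeration[OF pair_graphD(1)[OF assms(1)]] by auto
  have A: "?A \<in> carrier_mat (length ?xs) (length ?xs)"
    by (simp add: adjacency_mat_def)
  have "?A $$ (i, j) = ?A $$ (j, i)" if "i < length ?xs" "j < length ?xs" for i j
    using that pair_graphD(3)[OF assms(1)] by (auto simp: adjacency_mat_def)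
  moreover have "length ?xs > 0" using xs(2) assms(2) by (metis length_greater_0_conv set_empty)
  ultimately obtain k where "eigenvalue ?A k"
    using symmetric_real_mat_has_eigenvalue[OF A] by blast
  then have "spectrum ?A \<noteq> {}" by (auto simp: spectrum_def)
  then have "graph_rho G \<in> spectrum ?A"
    unfolding graph_rho_def using card_finite_spectrum(1)[OF A] by (intro Max_in)
  then show thesis
    unfolding spectrum_def mem_Collect_eq eigenvalue_adjacency_mat_iff[OF xs] using that by blast
qed

section \<open>Eigenvalues against size and minimum degree\<close>

lemma vertex_degree_eq_card_Image:
  "vertex_degree G v = card (parcs G `` {v})"
proof -
  have "out_arcs (with_proj G) v = Pair v ` (parcs G `` {v})"
    by (auto simp: out_arcs_def)
  then show ?thesis
    by (simp add: out_degree_def card_image inj_on_def)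
qed

text \<open>The degree vector serves as test vector. With \<open>A\<close> the adjacency matrix and
  \<open>y\<close> the absolute values of \<open>f\<close>,
  \<open>A d \<le> M + (\<delta> - 1) d\<close> and \<open>k y \<le> A y\<close> hold entrywise.
  Pairing \<open>k y \<le> A y\<close> with the all-ones vector and with \<open>d\<close>, and using
  the symmetry of \<open>A\<close>, gives the bound after division by the sum of
  \<open>y\<close>.\<close>

lemma eigenvalue_size_bound:
  assumes "finite V" "E \<subseteq> V \<times> V" "sym E" "irrefl E"
    and deg: "\<And>v. v \<in> V \<Longrightarrow> \<delta> \<le> real (card (E `` {v}))"
    and "k \<ge> 0" "k \<ge> \<delta> - 1"
    and nz: "\<exists>v\<in>V. f v \<noteq> 0"
    and eig: "\<And>v. v \<in> V \<Longrightarrow> (\<Sum>u\<in>V. (if (v, u) \<in> E then 1 else 0) * f u) = k * f v"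
  shows "k * (k - \<delta> + 1) \<le> real (card E) - (real (card V) - 1) * \<delta>"
proof -
  define a where "a v u = (if (v, u) \<in> E then 1 else 0 :: real)" for v u
  define d where "d v = (\<Sum>u\<in>V. a v u)" for v
  define y where "y v = \<bar>f v\<bar>" for v
  have asym: "a u v = a v u" for u v
    using assms(3) by (auto simp: a_def dest: symD)
  have a: "0 \<le> a v u" "a v u \<le> 1" "a v v = 0" for v u
    using assms(4) by (auto simp: a_def irrefl_def)
  have d_eq: "d v = real (card (E `` {v}))" for v
  proof -
    have "d v = (\<Sum>u\<in>E `` {v}. 1)"
      unfolding d_def a_def using assms(1,2) by (intro sum.mono_neutral_cong_right) auto
    then show ?thesis by simp
  qed
  have d: "\<delta> \<le> d v" if "v \<in> V" for v using deg[OF that] by (simp add: d_eq)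
  have d0: "0 \<le> d v" for v by (simp add: d_eq)
  have E: "(\<Sum>v\<in>V. d v) = real (card E)"
  proof -
    have "E = Sigma V (\<lambda>v. E `` {v})" using assms(2) by auto
    then have "card E = (\<Sum>v\<in>V. card (E `` {v}))"
      using assms(1,2) by (metis card_SigmaI finite_Image finite_SigmaI finite_subset)
    then show ?thesis by (simp add: d_eq)
  qed
  define M where "M = real (card E) - (real (card V) - 1) * \<delta>"
  have row: "(\<Sum>u\<in>V. a v u * d u) \<le> M + (\<delta> - 1) * d v" if v: "v \<in> V" for v
  proof -
    \<comment> \<open>The sum runs over the non-neighbours of \<open>v\<close>, including
      \<open>v\<close> itself. All its terms are nonnegative, and only the one at \<open>v\<close>
      is kept.\<close>
    have "(1 - a v v) * (d v - \<delta>) \<le> (\<Sum>u\<in>V. (1 - a v u) * (d u - \<delta>))"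
      using assms(1) v a d by (intro member_le_sum) auto
    also have "\<dots> = (\<Sum>u\<in>V. d u) - (\<Sum>u\<in>V. a v u * d u) - real (card V) * \<delta> + \<delta> * d v"
      by (simp add: d_def[of v] algebra_simps sum_subtractf sum.distrib sum_distrib_left)
    finally show ?thesis using E a(3) by (simp add: M_def algebra_simps)
  qed
  \<comment> \<open>Taking absolute values gives a nonnegative subeigenvector, so no Perron vector
    is called for.\<close>
  have sub: "k * y v \<le> (\<Sum>u\<in>V. a v u * y u)" if "v \<in> V" for v
  proof -
    have "k * y v = \<bar>\<Sum>u\<in>V. a v u * f u\<bar>"
      using eig[OF that] \<open>k \<ge> 0\<close> by (simp add: a_def y_def abs_mult)
    also have "\<dots> \<le> (\<Sum>u\<in>V. \<bar>a v u * f u\<bar>)" by (rule sum_abs)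
    finally show ?thesis using a by (simp add: y_def abs_mult)
  qed
  define Y where "Y = (\<Sum>v\<in>V. y v)"
  define D where "D = (\<Sum>v\<in>V. y v * d v)"
  obtain v0 where "v0 \<in> V" "f v0 \<noteq> 0" using nz by blast
  then have "Y > 0"
    unfolding Y_def using assms(1) by (intro sum_pos2[of _ v0]) (auto simp: y_def)
  have "k * Y \<le> (\<Sum>v\<in>V. \<Sum>u\<in>V. a v u * y u)"
    unfolding Y_def sum_distrib_left by (intro sum_mono sub)
  also have "\<dots> = (\<Sum>u\<in>V. \<Sum>v\<in>V. a v u * y u)" by (rule sum.swap)
  also have "\<dots> = D"
    unfolding D_def d_def by (intro sum.cong refl) (simp add: sum_distrib_left asym mult.commute)
  finally have kY: "k * Y \<le> D" .
  have "k * D = (\<Sum>v\<in>V. d v * (k * y v))"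
    by (simp add: D_def sum_distrib_left algebra_simps)
  also have "\<dots> \<le> (\<Sum>v\<in>V. d v * (\<Sum>u\<in>V. a v u * y u))"
    using sub d0 by (intro sum_mono mult_left_mono) auto
  also have "\<dots> = (\<Sum>v\<in>V. \<Sum>u\<in>V. d v * (a v u * y u))"
    by (simp add: sum_distrib_left)
  also have "\<dots> = (\<Sum>u\<in>V. \<Sum>v\<in>V. d v * (a v u * y u))"
    by (rule sum.swap)
  also have "\<dots> = (\<Sum>u\<in>V. y u * (\<Sum>v\<in>V. a u v * d v))"
    by (intro sum.cong refl) (simp add: sum_distrib_left asym algebra_simps)
  also have "\<dots> \<le> (\<Sum>u\<in>V. y u * (M + (\<delta> - 1) * d u))"
    using row by (intro sum_mono mult_left_mono) (auto simp: y_def)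
  also have "\<dots> = (\<Sum>u\<in>V. M * y u + (\<delta> - 1) * (y u * d u))"
    by (intro sum.cong refl) (simp add: algebra_simps)
  also have "\<dots> = M * Y + (\<delta> - 1) * D"
    by (simp only: Y_def D_def sum_distrib_left sum.distrib)
  finally have "(k - \<delta> + 1) * D \<le> M * Y"
    by (simp add: algebra_simps)
  moreover have "(k - \<delta> + 1) * (k * Y) \<le> (k - \<delta> + 1) * D"
    using kY assms(7) by (intro mult_left_mono) auto
  ultimately have "(k * (k - \<delta> + 1)) * Y \<le> M * Y"
    by (simp add: algebra_simps)
  then show ?thesis
    using \<open>Y > 0\<close> by (simp add: M_def)
qed

section \<open>Spectral radius of the extremal graph\<close>

text \<open>For vectors constant on the three blocks the eigenvalue equation becomes a cubic, which
  changes sign between \<open>n - \<delta>\<close>, the spectral radius of a complete graph on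
  \<open>n - \<delta> + 1\<close> vertices, and \<open>n\<close>.\<close>

lemma graph_rho_extremal_graph_gt:
  assumes "\<delta> \<ge> 2" "n \<ge> 2 * \<delta>"
  shows "graph_rho (extremal_graph n \<delta>) > real n - real \<delta>"
proof -
  define N T where "N = n - 2 * \<delta> + 1" and "T = \<delta> - 1"
  define s m t where "s = real \<delta>" and "m = real N" and "t = real T"
  have pos: "s \<ge> 2" "m \<ge> 1" "t \<ge> 1"
    using assms by (auto simp: s_def m_def t_def N_def T_def)
  have n: "real n - real \<delta> = s + m - 1"
    using assms by (simp add: s_def m_def N_def of_nat_diff)
  \<comment> \<open>the characteristic polynomial of the quotient of the adjacency matrix by the three blocks\<close>
  define p where "p x = (x - s + 1) * (x - m + 1) * x - m * s * x - t * s * (x - m + 1)" for x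
  have p0: "p (s + m - 1) < 0"
  proof -
    have "p (s + m - 1) = - (t * s * s)" by (simp add: p_def algebra_simps)
    then show ?thesis using pos by simp
  qed
  have p1: "p (s + m + t) > 0"
  proof -
    have "p (s + m + t) = (m * t + m + s + t * t + 2 * t + 1) * (s + m + t) + t * s * (m - 1)"
      by (simp add: p_def algebra_simps)
    moreover have "(m * t + m + s + t * t + 2 * t + 1) * (s + m + t) > 0"
      using pos by (intro mult_pos_pos add_pos_pos) auto
    ultimately show ?thesis using pos by (simp add: add_pos_nonneg)
  qed
  have "\<exists>x\<ge>s + m - 1. x \<le> s + m + t \<and> p x = 0"
    using p0 p1 pos unfolding p_def
    by (intro IVT') (auto intro!: continuous_intros)
  then obtain x where x: "x \<ge> s + m - 1" "p x = 0" by blast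
  have "x \<noteq> s + m - 1" using x(2) p0 by auto
  then have x1: "x > s + m - 1" using x(1) by simp
  then have x2: "x - m + 1 > 0" "x > 0" using pos by auto
  \<comment> \<open>With value 1 on the block of size \<open>\<delta>\<close>, the equations on the
    other two blocks determine \<open>b\<close> and \<open>c\<close>. The remaining equation,
    cleared of denominators, is \<open>p x = 0\<close>.\<close>
  define b where "b = s / (x - m + 1)"
  define c where "c = s / x"
  define f :: "nat + nat + nat \<Rightarrow> real" where "f = case_sum (\<lambda>_. 1) (case_sum (\<lambda>_. b) (\<lambda>_. c))"
  have b: "s + (m - 1) * b = x * b" and c: "s = x * c"
    using x2 by (simp_all add: b_def c_def field_simps)
  have "(s - 1) + m * b + t * c = x"
  proof -
    have "((s - 1) + m * b + t * c - x) * ((x - m + 1) * x)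
        = (s - 1 - x) * ((x - m + 1) * x) + m * (b * (x - m + 1)) * x + t * (c * x) * (x - m + 1)"
      by (simp only: ring_distribs ac_simps)
    also have "b * (x - m + 1) = s" using x2 by (simp add: b_def)
    also have "c * x = s" using x2 by (simp add: c_def)
    also have "(s - 1 - x) * ((x - m + 1) * x) + m * s * x + t * s * (x - m + 1) = - p x"
      by (simp add: p_def algebra_simps)
    finally show ?thesis using x(2) x2 by simp
  qed
  note abc = this b c
  let ?G = "extremal_graph n \<delta>"
  have verts: "pverts ?G = {..<\<delta>} <+> ({..<N} <+> {..<T})"
    by (simp add: N_def T_def extremal_graph_def graph_join_def graph_disjoint_union_def complete_ugraph_def
        isolated_ugraph_def)
  have sumV: "(\<Sum>u\<in>pverts ?G. g u) = (\<Sum>i<\<delta>. g (Inl i)) + ((\<Sum>i<N. g (Inr (Inl i)))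
      + (\<Sum>i<T. g (Inr (Inr i))))" for g :: "nat + nat + nat \<Rightarrow> real"
    unfolding verts by (simp add: sum.Plus)
  have arcs: "(Inl i, Inl j) \<in> parcs ?G \<longleftrightarrow> i < \<delta> \<and> j < \<delta> \<and> i \<noteq> j"
    "(Inr u, Inr w) \<in> parcs ?G \<longleftrightarrow>
      (\<exists>i j. u = Inl i \<and> w = Inl j \<and> i < N \<and> j < N \<and> i \<noteq> j)"
    "(Inl i, Inr w) \<in> parcs ?G \<longleftrightarrow> i < \<delta> \<and> w \<in> {..<N} <+> {..<T}"
    "(Inr w, Inl i) \<in> parcs ?G \<longleftrightarrow> i < \<delta> \<and> w \<in> {..<N} <+> {..<T}"
    "Inl j \<in> {..<N} <+> {..<T} \<longleftrightarrow> j < N" "Inr j \<in> {..<N} <+> {..<T} \<longleftrightarrow> j < T" for i j u w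
    by (auto simp: N_def T_def extremal_graph_def graph_join_def graph_disjoint_union_def complete_ugraph_def
        isolated_ugraph_def)
  \<comment> \<open>A vertex of a complete block is not its own neighbour, hence the factor
    \<open>real N - 1\<close>.\<close>
  have one_off: "(\<Sum>j<N. (if j < N \<and> i \<noteq> j then 1 else 0) * z) = (real N - 1) * z"
    if "i < N" for i N :: nat and z :: real
  proof -
    have "(\<Sum>j<N. (if j < N \<and> i \<noteq> j then 1 else 0) * z) = (\<Sum>j\<in>{..<N} - {i}. z)"
      by (intro sum.mono_neutral_cong_right) auto
    then show ?thesis using that by (simp add: of_nat_diff)
  qed
  have eig: "(\<Sum>u\<in>pverts ?G. (if (v, u) \<in> parcs ?G then 1 else 0) * f u) = x * f v"
    if v: "v \<in> pverts ?G" for v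
  proof -
    consider i where "v = Inl i" "i < \<delta>" | i where "v = Inr (Inl i)" "i < N"
      | i where "v = Inr (Inr i)" "i < T"
      using v unfolding verts by auto
    then show ?thesis
    proof cases
      case 1
      have "(\<Sum>u\<in>pverts ?G. (if (v, u) \<in> parcs ?G then 1 else 0) * f u) = (s - 1) + (m * b + t * c)"
        unfolding sumV 1 arcs f_def using one_off[OF 1(2), of 1] 1(2)
        by (simp add: s_def m_def t_def)
      then show ?thesis using abc 1 by (simp add: f_def)
    next
      case 2
      have "(\<Sum>u\<in>pverts ?G. (if (v, u) \<in> parcs ?G then 1 else 0) * f u) = s + (m - 1) * b"
        unfolding sumV 2 arcs f_def using one_off[OF 2(2), of b] 2(2)
        by (simp add: s_def m_def t_def)
      then show ?thesis using abc 2 by (simp add: f_def)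
    next
      case 3
      have "(\<Sum>u\<in>pverts ?G. (if (v, u) \<in> parcs ?G then 1 else 0) * f u) = s"
        unfolding sumV 3 arcs f_def using 3(2)
        by (simp add: s_def)
      then show ?thesis using abc 3 by (simp add: f_def)
    qed
  qed
  have "x \<le> graph_rho ?G"
  proof (rule eigenvalue_le_graph_rho[OF pair_graph_extremal_graph])
    show "Inl 0 \<in> pverts ?G" using assms by (auto simp: verts)
    show "f (Inl 0) \<noteq> 0" by (simp add: f_def)
  qed (rule eig)
  then show ?thesis using x1 n by simp
qed

section \<open>Even factors and the final comparison\<close>

lemma wf_digraph_with_proj:
  assumes "pair_graph G"
  shows "wf_digraph (with_proj G)"
proof -
  interpret pair_graph G by fact
  show ?thesis by unfold_locales
qed

text \<open>Covering every vertex excludes degree 0, and a nonzero even degree is at least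
  2.\<close>

lemma even_factor_of_even_rel:
  assumes "pair_graph G" "P \<subseteq> parcs G" "even_rel P" "pverts G \<subseteq> Domain P"
  shows "even_factor \<lparr>pverts = pverts G, parcs = P\<rparr> G" (is "even_factor ?F G")
proof -
  have F: "pair_graph ?F"
  proof (rule pair_graphI)
    show "finite (pverts ?F)" using pair_graphD(1)[OF assms(1)] by simp
    show "u \<in> pverts ?F \<and> v \<in> pverts ?F \<and> u \<noteq> v" if "(u, v) \<in> parcs ?F" for u v
    proof -
      have "(u, v) \<in> parcs G" using that assms(2) by auto
      then show ?thesis using pair_graphD(2)[OF assms(1)] by simp
    qed
    show "(v, u) \<in> parcs ?F" if "(u, v) \<in> parcs ?F" for u v
      using that assms(3) by (auto simp: even_rel_def dest: symD)
  qed
  have fin: "finite (P `` {v})" for v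
  proof (rule finite_subset)
    show "P `` {v} \<subseteq> pverts G"
    proof
      fix u assume "u \<in> P `` {v}"
      then have "(v, u) \<in> parcs G" using assms(2) by auto
      then show "u \<in> pverts G" using pair_graphD(2)[OF assms(1)] by simp
    qed
  qed (rule pair_graphD(1)[OF assms(1)])
  have "spanning (with_proj ?F) (with_proj G)"
    unfolding spanning_def subgraph_def
    using assms(2) wf_digraph_with_proj[OF F] wf_digraph_with_proj[OF assms(1)]
      compatibleI_with_proj by simp
  moreover have "even (vertex_degree ?F v) \<and> vertex_degree ?F v \<ge> 2" if "v \<in> pverts G" for v
  proof -
    have "P `` {v} \<noteq> {}" using that assms(4) by blast
    then have "card (P `` {v}) \<noteq> 0" using fin by simp
    moreover have "even (card (P `` {v}))" using assms(3) by (simp add: even_rel_def)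
    ultimately show ?thesis
      unfolding vertex_degree_eq_card_Image pair_pre_digraph.simps by presburger
  qed
  ultimately show ?thesis
    using F by (simp add: even_factor_def)
qed

theorem theorem1p2:
  fixes G :: "'a pair_pre_digraph" and n \<delta> :: nat
  assumes "\<delta> \<ge> 2"
    and "pair_graph G"
    and "Digraph_Component.connected (with_proj G)"
    and "card (pverts G) = n"
    and "even n"
    and "real n \<ge> max (5 * real \<delta> - 3) (1 / 3 * real \<delta> ^ 2 + real \<delta>)"
    and "min_degree G = \<delta>"
    and "graph_rho G \<ge> graph_rho (extremal_graph n \<delta>)"
    and "\<not> digraph_iso (with_proj G) (with_proj (extremal_graph n \<delta>))"
  shows "\<exists>F. even_factor F G"
proof (rule ccontr)
  assume no_factor: "\<nexists>F. even_factor F G"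
  let ?V = "pverts G" and ?E = "parcs G"
  note G = pair_graphD[OF assms(2)]
  have E: "?E \<subseteq> ?V \<times> ?V" "sym ?E" "irrefl ?E"
    using G(2,3) by (auto simp: sym_def irrefl_def)
  have finE: "finite ?E" using E(1) G(1) by (meson finite_SigmaI finite_subset)
  have "real n \<ge> 2 * real \<delta>" using assms(1,6) by simp
  then have n: "n \<ge> 2 * \<delta>" by linarith
  have deg: "\<delta> \<le> card (?E `` {v})" if "v \<in> ?V" for v
    using that G(1) assms(7) unfolding min_degree_def vertex_degree_eq_card_Image
    by (metis Min_le finite_imageI imageI)
  define k where "k = graph_rho G"
  have k: "k > real n - real \<delta>"
    using graph_rho_extremal_graph_gt[OF assms(1) n] assms(8) by (simp add: k_def)
  have "?V \<noteq> {}" using assms(1,4) n by auto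
  then obtain f where "\<exists>v\<in>?V. f v \<noteq> 0"
    "\<And>v. v \<in> ?V \<Longrightarrow> (\<Sum>u\<in>?V. (if (v, u) \<in> ?E then 1 else 0) * f u) = k * f v"
    using graph_rho_eigenvector[OF assms(2)] unfolding k_def by blast
  then have lower: "k * (k - real \<delta> + 1) \<le> real (card ?E) - (real n - 1) * real \<delta>"
    using eigenvalue_size_bound[OF G(1) E, of "real \<delta>" k f] deg k n assms(4) by auto
  \<comment> \<open>An even subgraph covering all vertices would be an even factor, so the exchange
    argument applies to \<open>G\<close>.\<close>
  obtain v where v: "v \<in> ?V" "\<And>a b. (v, a) \<in> ?E \<Longrightarrow> (v, b) \<in> ?E \<Longrightarrow> (a, b) \<notin> ?E"
    "\<And>w. w \<noteq> v \<Longrightarrow> card (?E `` {w} \<inter> ?E `` {v}) \<le> 2"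
    using sparse_neighbourhood_of_uncovered_vertex[OF finE E(2,3), of ?V]
      even_factor_of_even_rel[OF assms(2)] no_factor by metis
  define d where "d = card (?E `` {v})"
  have "?E `` {v} \<subseteq> ?V - {v}" using E(1,3) by (auto simp: irrefl_def)
  then have "d \<le> card (?V - {v})"
    unfolding d_def using G(1) by (intro card_mono) auto
  then have "d \<le> n - 1" using v(1) G(1) assms(4) by simp
  \<comment> \<open>The number of vertices other than \<open>v\<close> that are not adjacent to
    \<open>v\<close>.\<close>
  moreover define r where "r = n - 1 - d"
  ultimately have r: "n = 1 + d + r"
    using n assms(1) by simp
  have "card ?E \<le> r * r + 3 * r + 2 * d"
    unfolding d_def using card_le_of_sparse_neighbourhood[OF G(1) E v, of r] assms(4) r d_def by simp
  then have upper: "real (card ?E) \<le> real r * real r + 3 * real r + 2 * real d"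
    by (metis (mono_tags) of_nat_add of_nat_le_iff of_nat_mult of_nat_numeral)
  have d: "real \<delta> \<le> real d" using deg[OF v(1)] by (simp add: d_def)
  have nr: "real n = 1 + real d + real r" using r by simp
  \<comment> \<open>The lower bound \<open>k * (k - \<delta> + 1)\<close> increases with
    \<open>k\<close>, so its value at \<open>n - \<delta>\<close> is strictly exceeded.\<close>
  have "(real n - real \<delta>) * (real n - 2 * real \<delta> + 1) < k * (k - real \<delta> + 1)"
    using k n by (intro mult_strict_mono) auto
  then have "(real n - real \<delta>) * (real n - 2 * real \<delta> + 1)
      < real r * real r + 3 * real r + 2 * real d - (real n - 1) * real \<delta>"
    using lower upper by linarith
  \<comment> \<open>This product is the amount by which the upper bound on \<open>card ?E\<close>
    grows when \<open>d\<close> is replaced by \<open>\<delta>\<close>.\<close>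
  moreover have "0 \<le> (real d - real \<delta>) * (2 * (real n - 1) - (real d + real \<delta> - 1))"
    using d nr by (intro mult_nonneg_nonneg) auto
  \<comment> \<open>After that replacement the left side of the strict inequality exceeds the right
    by exactly this product. It vanishes at \<open>\<delta> = 2\<close>, where strictness gives the
    contradiction.\<close>
  moreover have "0 \<le> (real \<delta> - 1) * (real \<delta> - 2)"
    using assms(1) by simp
  ultimately show False
    unfolding nr by (simp add: algebra_simps)
qed

end
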